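(* Let $\Gamma$ be a (valued) tree with associated matrices $D,F$ ($F=D^t$ in the simply-laced case) and Coxeter transformation ${\bf C}=w_1w_2$. 1) The matrices $DF$ and $FD$ have the same non-zero eigenvalues with equal multiplicities. 2) The eigenvalues $\varphi_i$ of $DF$ and $FD$ are non-negative: $\varphi_i\ge0$. 3) The eigenvalues of ${\bf C}$ corresponding to $\varphi_i$ (via $\varphi_i=\frac{(\lambda+1)^2}{4\lambda}$) are $$\lambda^{\varphi_i}_{1,2}=2\varphi_i-1\pm2\sqrt{\varphi_i(\varphi_i-1)}.$$ The eigenvalues $\lambda^{\varphi_i}_{1,2}$ either lie on the unit circle or are real positive numbers; in the latter case they are mutually inverse: $\lambda_1^{\varphi_i}\lambda_2^{\varphi_i}=1$.
   Context: $\Gamma$ is a finite connected valued graph without cycles with generalized Cartan matrix $K$ ($k_{ii}=2$, $k_{ij}$ nonpositive integers for $i\neq j$, $k_{ij}=0\iff k_{ji}=0$), which is then symmetrizable, $K=T{\bf B}$ with $T$ positive diagonal and ${\bf B}$ symmetric. The vertices are split into two classes such that every edge joins the two classes, and in block form $$K=\begin{pmatrix}2I&2D\\2F&2I\end{pmatrix},\quad w_1=\begin{pmatrix}-I&-2D\\0&I\end{pmatrix},\quad w_2=\begin{pmatrix}I&0\\-2F&-I\end{pmatrix}.$$ In the simply-laced case $DF=DD^t$ and $FD=D^tD$. *)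

theory Defs
  imports "HOL-Analysis.Analysis" "Jordan_Normal_Form.Char_Poly"
    "Jordan_Normal_Form.Matrix_Kernel"
begin

text \<open>A valued graph is given by its finite vertex set and its generalized Cartan matrix, indexed
  by vertices; entries of \<open>k\<close> outside \<open>V\<close> play no role.\<close>

definition generalized_cartan_matrix :: "'v set \<Rightarrow> ('v \<Rightarrow> 'v \<Rightarrow> int) \<Rightarrow> bool" where
  "generalized_cartan_matrix V k \<longleftrightarrow>
     (\<forall>u\<in>V. k u u = 2) \<and>
     (\<forall>u\<in>V. \<forall>v\<in>V. u \<noteq> v \<longrightarrow> k u v \<le> 0) \<and>
     (\<forall>u\<in>V. \<forall>v\<in>V. u \<noteq> v \<longrightarrow> (k u v = 0 \<longleftrightarrow> k v u = 0))"

definition edges :: "'v set \<Rightarrow> ('v \<Rightarrow> 'v \<Rightarrow> int) \<Rightarrow> 'v rel" where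
  "edges V k = {(u, v). u \<in> V \<and> v \<in> V \<and> u \<noteq> v \<and> k u v \<noteq> 0}"

text \<open>Cycles are cycles of the undirected graph, so they visit at least three distinct vertices.
  (The symmetric relation \<open>edges V k\<close> contains both orientations of every edge, hence acyclicity in
  the sense of directed graphs would be the wrong notion.)\<close>

definition is_cycle :: "'v rel \<Rightarrow> 'v list \<Rightarrow> bool" where
  "is_cycle E p \<longleftrightarrow>
     length p \<ge> 3 \<and> distinct p \<and> successively (\<lambda>u v. (u, v) \<in> E) p \<and> (last p, hd p) \<in> E"

definition valued_tree :: "'v set \<Rightarrow> ('v \<Rightarrow> 'v \<Rightarrow> int) \<Rightarrow> bool" where
  "valued_tree V k \<longleftrightarrow>
     finite V \<and> V \<noteq> {} \<and> generalized_cartan_matrix V k \<and>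
     (\<forall>u\<in>V. \<forall>v\<in>V. (u, v) \<in> (edges V k)\<^sup>*) \<and>
     (\<nexists>p. is_cycle (edges V k) p)"

text \<open>The two classes of vertices, each listed in the order in which it indexes the block matrices.\<close>

definition bipartite_enumeration ::
    "'v set \<Rightarrow> ('v \<Rightarrow> 'v \<Rightarrow> int) \<Rightarrow> 'v list \<Rightarrow> 'v list \<Rightarrow> bool" where
  "bipartite_enumeration V k xs ys \<longleftrightarrow>
     distinct (xs @ ys) \<and> set (xs @ ys) = V \<and>
     (\<forall>(u, v)\<in>edges V k. (u \<in> set xs \<and> v \<in> set ys) \<or> (u \<in> set ys \<and> v \<in> set xs))"

text \<open>Matrices have complex entries throughout, since eigenvalues are meant over the complex
  numbers.\<close>

definition cartan_block :: "('v \<Rightarrow> 'v \<Rightarrow> int) \<Rightarrow> 'v list \<Rightarrow> 'v list \<Rightarrow> complex mat" where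
  "cartan_block k us vs = mat (length us) (length vs) (\<lambda>(i, j). of_int (k (us ! i) (vs ! j)))"

definition D_mat :: "('v \<Rightarrow> 'v \<Rightarrow> int) \<Rightarrow> 'v list \<Rightarrow> 'v list \<Rightarrow> complex mat" where
  "D_mat k xs ys = (1 / 2) \<cdot>\<^sub>m cartan_block k xs ys"

definition F_mat :: "('v \<Rightarrow> 'v \<Rightarrow> int) \<Rightarrow> 'v list \<Rightarrow> 'v list \<Rightarrow> complex mat" where
  "F_mat k xs ys = (1 / 2) \<cdot>\<^sub>m cartan_block k ys xs"

lemma cartan_block_form:
  assumes "valued_tree V k" and "bipartite_enumeration V k xs ys"
  shows "cartan_block k (xs @ ys) (xs @ ys) =
    four_block_mat (2 \<cdot>\<^sub>m 1\<^sub>m (length xs)) (2 \<cdot>\<^sub>m D_mat k xs ys)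
                   (2 \<cdot>\<^sub>m F_mat k xs ys) (2 \<cdot>\<^sub>m 1\<^sub>m (length ys))"
proof -
  have diag: "k u u = 2" if "u \<in> V" for u
    using assms(1) that by (auto simp: valued_tree_def generalized_cartan_matrix_def)
  have d: "distinct xs" "distinct ys" "set xs \<inter> set ys = {}" and V: "V = set xs \<union> set ys"
    using assms(2) by (auto simp: bipartite_enumeration_def)
  have off: "k u v = 0"
    if "u \<noteq> v" "(u \<in> set xs \<and> v \<in> set xs) \<or> (u \<in> set ys \<and> v \<in> set ys)" for u v
  proof (rule ccontr)
    assume "k u v \<noteq> 0"
    then have "(u, v) \<in> edges V k" using that V by (auto simp: edges_def)
    then show False using assms(2) that d(3) by (auto simp: bipartite_enumeration_def)
  qed
  have xx: "k (xs ! i) (xs ! j) = (if i = j then 2 else 0)" if "i < length xs" "j < length xs" for i j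
    using that diag off d V by (auto simp: nth_eq_iff_index_eq)
  have yy: "k (ys ! i) (ys ! j) = (if i = j then 2 else 0)" if "i < length ys" "j < length ys" for i j
    using that diag off d V by (auto simp: nth_eq_iff_index_eq)
  show ?thesis
    by (rule eq_matI) (auto simp: cartan_block_def D_mat_def F_mat_def nth_append xx yy)
qed

definition w1_mat :: "complex mat \<Rightarrow> complex mat" where
  "w1_mat D = four_block_mat
     (- 1\<^sub>m (dim_row D)) (- (2 \<cdot>\<^sub>m D))
     (0\<^sub>m (dim_col D) (dim_row D)) (1\<^sub>m (dim_col D))"

definition w2_mat :: "complex mat \<Rightarrow> complex mat" where
  "w2_mat F = four_block_mat
     (1\<^sub>m (dim_col F)) (0\<^sub>m (dim_col F) (dim_row F))
     (- (2 \<cdot>\<^sub>m F)) (- 1\<^sub>m (dim_row F))"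

definition coxeter_transformation :: "complex mat \<Rightarrow> complex mat \<Rightarrow> complex mat" where
  "coxeter_transformation D F = w1_mat D * w2_mat F"

definition alg_mult :: "complex mat \<Rightarrow> complex \<Rightarrow> nat" where
  "alg_mult A \<mu> = Polynomial.order \<mu> (char_poly A)"

definition geom_mult :: "complex mat \<Rightarrow> complex \<Rightarrow> nat" where
  "geom_mult A \<mu> = kernel_dim (char_matrix A \<mu>)"

text \<open>\<open>\<phi>\<close> is a complex number here, hence the complex square root; that \<open>\<phi>\<close> is real and
  non-negative when it is an eigenvalue is part of the theorem.\<close>

definition lambda1 :: "complex \<Rightarrow> complex" where
  "lambda1 \<phi> = 2 * \<phi> - 1 + 2 * csqrt (\<phi> * (\<phi> - 1))"

definition lambda2 :: "complex \<Rightarrow> complex" where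
  "lambda2 \<phi> = 2 * \<phi> - 1 - 2 * csqrt (\<phi> * (\<phi> - 1))"

definition pos_real :: "complex \<Rightarrow> bool" where
  "pos_real z \<longleftrightarrow> z \<in> \<real> \<and> Re z > 0"

end

theory Submission
  imports Defs
begin

text \<open>
The first claim holds for any two matrices \<open>A\<close>, \<open>B\<close> with both products defined: \<open>B\<close> carries the
eigenspace of \<open>A B\<close> for \<open>\<mu> \<noteq> 0\<close> isomorphically onto that of \<open>B A\<close>
(\<open>geom_mult_mult_commute\<close>), and the characteristic polynomials of \<open>A B\<close> and \<open>B A\<close> agree up to
powers of the indeterminate (\<open>char_poly_mult_commute\<close>).

For the second claim, a generalized Cartan matrix on a graph without cycles is symmetrizable
(\<open>forest_symmetrizable\<close>): weights can be chosen one leaf after the other. In the weighted inner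
products \<open>F\<close> is adjoint to \<open>D\<close>, hence \<open>D F\<close> is positive semidefinite and its eigenvalues are real
and nonnegative (\<open>balanced_product_eigenvalue_nonneg\<close>).

For the third claim, \<open>w\<^sub>1\<close> is an involution, so \<open>w\<^sub>1 w\<^sub>2 u = z u\<close> can be written
\<open>w\<^sub>2 u = z w\<^sub>1 u\<close>. For \<open>u = (x, y)\<close> this says that \<open>F x\<close> is a certain multiple of \<open>y\<close> and \<open>D y\<close>
a certain multiple of \<open>x\<close>, and the product of the two factors is \<open>(z + 1)\<^sup>2 / (4 z)\<close>. Therefore
\<open>z\<close> is an eigenvalue of the Coxeter transformation if and only if \<open>z \<noteq> 0\<close> and this number is an
eigenvalue of \<open>D F\<close> or \<open>F D\<close> (\<open>coxeter_eigenvalue_iff\<close>). What remains is the quadratic equation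
\<open>\<phi> = (z + 1)\<^sup>2 / (4 z)\<close>, whose two roots have product 1; they are conjugate for
\<open>0 \<le> \<phi> \<le> 1\<close> and positive for \<open>\<phi> > 1\<close>.
\<close>

unbundle no vec_syntax

section \<open>Symmetrizability of generalized Cartan matrices without cycles\<close>

text \<open>
At the initial vertex \<open>v\<close> of a longest simple path every neighbour already lies on the path, since
otherwise the path could be prolonged. A neighbour other than the second vertex of the path would
close a cycle with the segment leading to it.
\<close>

lemma cycle_free_imp_leaf:
  fixes E :: "'v rel"
  assumes fin: "finite V" and ne: "V \<noteq> {}" and EV: "E \<subseteq> V \<times> V"
    and sym: "sym E" and irr: "irrefl E" and nocyc: "\<nexists>p. is_cycle E p"
  shows "\<exists>v\<in>V. \<exists>w. \<forall>u. (v, u) \<in> E \<longrightarrow> u = w"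
proof -
  define P where "P = {p. p \<noteq> [] \<and> distinct p \<and> set p \<subseteq> V \<and> successively (\<lambda>u v. (u, v) \<in> E) p}"
  have "finite P"
    by (rule finite_subset[OF _ finite_subset_distinct[OF fin]]) (auto simp: P_def)
  moreover obtain v0 where "v0 \<in> V" using ne by auto
  then have "[v0] \<in> P" by (simp add: P_def)
  ultimately have "Max (length ` P) \<in> length ` P" and "\<forall>q\<in>P. length q \<le> Max (length ` P)"
    by (auto intro!: Max_in)
  then obtain p where p: "p \<in> P" and longest: "\<And>q. q \<in> P \<Longrightarrow> length q \<le> length p"
    by auto
  then obtain v q where pv: "p = v # q" by (cases p) (auto simp: P_def)
  have "u = hd q" if vu: "(v, u) \<in> E" for u
  proof (rule ccontr)
    assume "u \<noteq> hd q"
    have uv: "(u, v) \<in> E" using vu sym by (meson symD)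
    have "u \<in> set p"
    proof (rule ccontr)
      assume "u \<notin> set p"
      then have "u # p \<in> P" using p uv EV pv by (auto simp: P_def)
      then show False using longest by fastforce
    qed
    moreover have "u \<noteq> v" using vu irr by (auto simp: irrefl_def)
    ultimately obtain as bs where q: "q = as @ u # bs" using pv by (auto simp: in_set_conv_decomp)
    then have "as \<noteq> []" using \<open>u \<noteq> hd q\<close> by auto
    then have "length (v # as @ [u]) \<ge> 3" by (cases as) auto
    moreover have "successively (\<lambda>u v. (u, v) \<in> E) ((v # as @ [u]) @ bs)" "distinct (v # as @ [u])"
      using p by (auto simp: P_def pv q)
    ultimately have "is_cycle E (v # as @ [u])"
      using uv by (auto simp: is_cycle_def successively_append_iff simp del: append.simps)
    then show False using nocyc by blast
  qed
  moreover have "v \<in> V" using p by (auto simp: P_def pv)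
  ultimately show ?thesis by blast
qed

lemma is_cycle_mono: "is_cycle E p \<Longrightarrow> E \<subseteq> E' \<Longrightarrow> is_cycle E' p"
  unfolding is_cycle_def by (auto elim: successively_mono)

text \<open>
The weights \<open>d\<close> make the matrix \<open>d u * k u v\<close> symmetric, which is the factorization \<open>K = T B\<close>
with \<open>T\<close> the inverse of the diagonal matrix of \<open>d\<close>. They are built leaf by leaf: a leaf \<open>v\<close>
is constrained by at most one neighbour \<open>w\<close>, so its weight can be solved for (or set to 1 at an
isolated vertex), and it is positive because \<open>k v w\<close> and \<open>k w v\<close> are both negative. 
\<close>

lemma forest_symmetrizable:
  fixes k :: "'v \<Rightarrow> 'v \<Rightarrow> int"
  assumes "finite V" and "generalized_cartan_matrix V k" and "\<nexists>p. is_cycle (edges V k) p"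
  shows "\<exists>d :: 'v \<Rightarrow> real. (\<forall>v\<in>V. d v > 0) \<and>
    (\<forall>u\<in>V. \<forall>v\<in>V. d u * of_int (k u v) = d v * of_int (k v u))"
  using assms
proof (induction V rule: finite_psubset_induct)
  case (psubset V)
  note cartan = psubset.prems(1)[unfolded generalized_cartan_matrix_def]
  show ?case
  proof (cases "V = {}")
    case False
    have "sym (edges V k)" "irrefl (edges V k)" "edges V k \<subseteq> V \<times> V"
      using cartan by (auto simp: edges_def sym_def irrefl_def)
    then obtain v w where v: "v \<in> V" and leaf: "\<And>u. (v, u) \<in> edges V k \<Longrightarrow> u = w"
      using cycle_free_imp_leaf[OF psubset.hyps False _ _ _ psubset.prems(2)] by metis
    have "edges (V - {v}) k \<subseteq> edges V k" by (auto simp: edges_def)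
    then have "\<nexists>p. is_cycle (edges (V - {v}) k) p"
      using psubset.prems(2) is_cycle_mono by metis
    moreover have "generalized_cartan_matrix (V - {v}) k"
      using cartan by (auto simp: generalized_cartan_matrix_def)
    ultimately obtain d :: "'v \<Rightarrow> real" where pos: "\<And>u. u \<in> V - {v} \<Longrightarrow> d u > 0"
      and bal: "\<And>a b. a \<in> V - {v} \<Longrightarrow> b \<in> V - {v} \<Longrightarrow> d a * of_int (k a b) = d b * of_int (k b a)"
      using psubset.IH[of "V - {v}"] v by (metis Diff_subset DiffD2 insertI1 psubsetI)
    define t where "t = (if (v, w) \<in> edges V k then d w * of_int (k w v) / of_int (k v w) else 1)"
    have w: "k w v < 0 \<and> k v w < 0 \<and> w \<in> V - {v}" if "(v, w) \<in> edges V k"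
      using that cartan by (auto simp: edges_def order_less_le)
    have "t > 0"
      unfolding t_def using w pos[of w]
      by (auto simp: zero_less_divide_iff mult_pos_neg)
    have vu: "t * of_int (k v u) = d u * of_int (k u v)" if u: "u \<in> V - {v}" for u
    proof (cases "(v, u) \<in> edges V k")
      case True
      then show ?thesis using leaf[OF True] w by (auto simp: t_def)
    next
      case False
      then have "k v u = 0" "k u v = 0" using u v cartan by (auto simp: edges_def)
      then show ?thesis by simp
    qed
    show ?thesis
      using pos \<open>t > 0\<close> bal vu by (intro exI[of _ "d(v := t)"]) auto
  qed auto
qed

section \<open>Nonzero eigenvalues of the two products of a pair of matrices\<close>

text \<open>
Both sides are determinants of products with the block matrix \<open>M = (X I, A; B, I)\<close>: clearing the
lower left block by column operations leaves \<open>X I - A B\<close> and \<open>I\<close> on the diagonal, clearing it by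
row operations (after scaling the second block row by \<open>X\<close>) leaves \<open>X I\<close> and \<open>X I - B A\<close>.
\<close>

lemma char_poly_mult_commute:
  fixes A B :: "'a :: idom mat"
  assumes A: "A \<in> carrier_mat n m" and B: "B \<in> carrier_mat m n"
  shows "monom 1 m * char_poly (A * B) = monom 1 n * char_poly (B * A)"
proof -
  define X :: "'a poly" where "X = monom 1 1"
  define A' where "A' = map_mat (\<lambda>a. [:a:]) A"
  define B' where "B' = map_mat (\<lambda>a. [:a:]) B"
  have c: "A' \<in> carrier_mat n m" "B' \<in> carrier_mat m n" using A B by (auto simp: A'_def B'_def)
  have cpm: "char_poly_matrix (P * Q) = X \<cdot>\<^sub>m 1\<^sub>m i + - (map_mat (\<lambda>a. [:a:]) P * map_mat (\<lambda>a. [:a:]) Q)"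
    if "P \<in> carrier_mat i j" "Q \<in> carrier_mat j i" for P Q :: "'a mat" and i j
  proof -
    interpret inj_comm_ring_hom "\<lambda>a :: 'a. [:a:]" by (unfold_locales) (auto simp: one_pCons)
    have "map_mat (\<lambda>a. [:a:]) (P * Q) = map_mat (\<lambda>a. [:a:]) P * map_mat (\<lambda>a. [:a:]) Q"
      using mat_hom_mult[OF that] .
    moreover have "char_poly_matrix (P * Q) = X \<cdot>\<^sub>m 1\<^sub>m i + - map_mat (\<lambda>a. [:a:]) (P * Q)"
      using that unfolding char_poly_matrix_def X_def
      by (intro eq_matI) (auto simp: monom_Suc)
    ultimately show ?thesis by simp
  qed
  \<comment> \<open>Right multiplication by \<open>?R\<close> performs the column operation,
    left multiplication by \<open>?L\<close> the row operation.\<close>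
  let ?M = "four_block_mat (X \<cdot>\<^sub>m 1\<^sub>m n) A' B' (1\<^sub>m m)"
  let ?R = "four_block_mat (1\<^sub>m n) (0\<^sub>m n m) (- B') (1\<^sub>m m)"
  let ?L = "four_block_mat (1\<^sub>m n) (0\<^sub>m n m) (- B') (X \<cdot>\<^sub>m 1\<^sub>m m)"
  have "?M * ?R = four_block_mat (char_poly_matrix (A * B)) A' (0\<^sub>m m n) (1\<^sub>m m)"
    using c unfolding cpm[OF A B] A'_def[symmetric] B'_def[symmetric]
    by (subst mult_four_block_mat[of _ n n _ m _ m _ _ n _ m]) auto
  moreover have "det (four_block_mat (char_poly_matrix (A * B)) A' (0\<^sub>m m n) (1\<^sub>m m)) = char_poly (A * B)"
    using A B c by (subst det_four_block_mat_lower_left_zero[of _ n _ m]) (auto simp: char_poly_def)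
  moreover have "det ?R = 1"
    using c by (subst det_four_block_mat_upper_right_zero[of _ n _ m]) auto
  moreover have "det (?M * ?R) = det ?M * det ?R"
    using c by (intro det_mult[of _ "n + m"]) auto
  ultimately have M: "det ?M = char_poly (A * B)" by simp
  have "?L * ?M = four_block_mat (X \<cdot>\<^sub>m 1\<^sub>m n) A' (0\<^sub>m m n) (char_poly_matrix (B * A))"
    using c unfolding cpm[OF B A] A'_def[symmetric] B'_def[symmetric]
    by (subst mult_four_block_mat[of _ n n _ m _ m _ _ n _ m]) (auto intro!: cong_four_block_mat)
  moreover have "det (four_block_mat (X \<cdot>\<^sub>m 1\<^sub>m n) A' (0\<^sub>m m n) (char_poly_matrix (B * A))) = X ^ n * char_poly (B * A)"
    using A B c by (subst det_four_block_mat_lower_left_zero[of _ n _ m]) (auto simp: char_poly_def)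
  moreover have "det ?L = X ^ m"
    using c by (subst det_four_block_mat_upper_right_zero[of _ n _ m]) auto
  moreover have "det (?L * ?M) = det ?L * det ?M"
    using c by (intro det_mult[of _ "n + m"]) auto
  ultimately have "X ^ m * char_poly (A * B) = X ^ n * char_poly (B * A)" using M by simp
  then show ?thesis by (simp add: X_def monom_power)
qed

text \<open>
The two characteristic polynomials differ only by powers of \<open>X\<close>, which have no root away from 0.
\<close>

lemma alg_mult_mult_commute:
  assumes A: "A \<in> carrier_mat n m" and B: "B \<in> carrier_mat m n" and \<mu>: "\<mu> \<noteq> 0"
  shows "alg_mult (A * B) \<mu> = alg_mult (B * A) \<mu>"
proof -
  have nz: "char_poly (A * B) \<noteq> 0" "char_poly (B * A) \<noteq> 0"
    using degree_monic_char_poly[of "A * B" n] degree_monic_char_poly[of "B * A" m] A B by auto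
  have [simp]: "Polynomial.order \<mu> (monom 1 i) = 0" for i
    using \<mu> by (auto simp: order_0I poly_monom)
  show ?thesis
    using arg_cong[OF char_poly_mult_commute[OF A B], of "Polynomial.order \<mu>"] nz
    by (simp add: order_mult alg_mult_def)
qed

lemma mem_mat_kernel_char_matrix:
  assumes "A \<in> carrier_mat n n" "v \<in> carrier_vec n"
  shows "v \<in> mat_kernel (char_matrix A \<mu>) \<longleftrightarrow> A *\<^sub>v v = \<mu> \<cdot>\<^sub>v (v :: 'a :: field vec)"
proof (cases "v = 0\<^sub>v n")
  case True
  then show ?thesis using assms by (auto simp: char_matrix_def mat_kernel_def)
next
  case False
  then show ?thesis
    using eigenvector_char_matrix[OF assms(1), of v \<mu>] assms mat_kernel[OF char_matrix_closed[OF assms(1)]]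
    by (auto simp: eigenvector_def)
qed

text \<open>
From \<open>A B v = \<mu> v\<close> follows \<open>B A (B v) = \<mu> (B v)\<close>. So \<open>B\<close> maps one eigenspace to the other, and
\<open>A\<close> maps back; on the eigenspaces the two composites are multiplication by \<open>\<mu>\<close>, hence
bijective when \<open>\<mu> \<noteq> 0\<close>.
\<close>

lemma mult_vec_swaps_eigenspaces:
  fixes A B :: "'a :: field mat"
  assumes A: "A \<in> carrier_mat n m" and B: "B \<in> carrier_mat m n"
    and v: "v \<in> mat_kernel (char_matrix (A * B) \<mu>)"
  shows "B *\<^sub>v v \<in> mat_kernel (char_matrix (B * A) \<mu>)" and "A *\<^sub>v (B *\<^sub>v v) = \<mu> \<cdot>\<^sub>v v"
    and "v \<in> carrier_vec n"
proof -
  have AB: "A * B \<in> carrier_mat n n" and BA: "B * A \<in> carrier_mat m m" using A B by auto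
  show vn: "v \<in> carrier_vec n" using mat_kernelD[OF char_matrix_closed[OF AB] v] by simp
  then have "(A * B) *\<^sub>v v = \<mu> \<cdot>\<^sub>v v" using v mem_mat_kernel_char_matrix[OF AB] by blast
  then show *: "A *\<^sub>v (B *\<^sub>v v) = \<mu> \<cdot>\<^sub>v v" using A B vn by simp
  have "(B * A) *\<^sub>v (B *\<^sub>v v) = B *\<^sub>v (A *\<^sub>v (B *\<^sub>v v))" using A B vn by simp
  also have "\<dots> = \<mu> \<cdot>\<^sub>v (B *\<^sub>v v)" unfolding * using mult_mat_vec[OF B vn] by simp
  finally show "B *\<^sub>v v \<in> mat_kernel (char_matrix (B * A) \<mu>)"
    using mem_mat_kernel_char_matrix[OF BA] B vn by auto
qed

lemma eigenvalue_iff_mat_kernel: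
  fixes A :: "'a :: field mat"
  assumes A: "A \<in> carrier_mat n n"
  shows "eigenvalue A \<mu> \<longleftrightarrow> (\<exists>v \<in> mat_kernel (char_matrix A \<mu>). v \<noteq> 0\<^sub>v n)"
  using eigenvalue_char_matrix[OF A] mat_kernel[OF char_matrix_closed[OF A]] by auto

lemma eigenvalue_mult_commute:
  fixes A B :: "'a :: field mat"
  assumes A: "A \<in> carrier_mat n m" and B: "B \<in> carrier_mat m n" and \<mu>: "\<mu> \<noteq> 0"
  shows "eigenvalue (A * B) \<mu> \<longleftrightarrow> eigenvalue (B * A) \<mu>"
proof -
  have step: "eigenvalue (Q * P) \<mu>"
    if P: "P \<in> carrier_mat i j" and Q: "Q \<in> carrier_mat j i" and ev: "eigenvalue (P * Q) \<mu>"
    for P Q :: "'a mat" and i j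
  proof -
    have PQ: "P * Q \<in> carrier_mat i i" and QP: "Q * P \<in> carrier_mat j j" using P Q by auto
    obtain v where v: "v \<in> mat_kernel (char_matrix (P * Q) \<mu>)" "v \<noteq> 0\<^sub>v i"
      using ev eigenvalue_iff_mat_kernel[OF PQ] by auto
    have "Q *\<^sub>v v \<noteq> 0\<^sub>v j"
    proof
      assume "Q *\<^sub>v v = 0\<^sub>v j"
      moreover have "P *\<^sub>v 0\<^sub>v j = 0\<^sub>v i" using P by auto
      ultimately have "\<mu> \<cdot>\<^sub>v v = 0\<^sub>v i" using mult_vec_swaps_eigenspaces(2)[OF P Q v(1)] by simp
      then show False
        using mult_vec_swaps_eigenspaces(3)[OF P Q v(1)] v(2) \<mu> by (auto simp: vec_eq_iff)
    qed
    then show ?thesis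
      using mult_vec_swaps_eigenspaces(1)[OF P Q v(1)] eigenvalue_iff_mat_kernel[OF QP] by blast
  qed
  show ?thesis using step[OF A B] step[OF B A] by blast
qed

lemma geom_mult_mult_commute:
  assumes A: "A \<in> carrier_mat n m" and B: "B \<in> carrier_mat m n" and \<mu>: "\<mu> \<noteq> 0"
  shows "geom_mult (A * B) \<mu> = geom_mult (B * A) \<mu>"
proof -
  have cAB: "char_matrix (A * B) \<mu> \<in> carrier_mat n n" and cBA: "char_matrix (B * A) \<mu> \<in> carrier_mat m m"
    using A B by auto
  interpret AB: kernel n n "char_matrix (A * B) \<mu>" by unfold_locales (rule cAB)
  interpret BA: kernel m m "char_matrix (B * A) \<mu>" by unfold_locales (rule cBA)
  note AB_ker = mult_vec_swaps_eigenspaces[OF A B, of _ \<mu>] and BA_ker = mult_vec_swaps_eigenspaces[OF B A, of _ \<mu>]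
  interpret lm: linear_map class_ring AB.VK BA.VK "\<lambda>v. B *\<^sub>v v"
    apply (unfold_locales)
    using AB_ker mult_add_distrib_mat_vec[OF B] mult_mat_vec[OF B]
    by (auto simp: LinearCombinations.module_hom_def class_ring_simps)
  have "AB.Ker.fin_dim"
    using kernel_basis_exists[OF cAB] AB.Ker.basis_def AB.Ker.fin_dim_def by auto
  moreover have "inj_on (\<lambda>v. B *\<^sub>v v) (mat_kernel (char_matrix (A * B) \<mu>))"
  proof (rule inj_onI)
    fix u v assume uv: "u \<in> mat_kernel (char_matrix (A * B) \<mu>)" "v \<in> mat_kernel (char_matrix (A * B) \<mu>)"
      "B *\<^sub>v u = B *\<^sub>v v"
    then have "\<mu> \<cdot>\<^sub>v u = \<mu> \<cdot>\<^sub>v v" using AB_ker(2) by metis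
    then have "inverse \<mu> \<cdot>\<^sub>v (\<mu> \<cdot>\<^sub>v u) = inverse \<mu> \<cdot>\<^sub>v (\<mu> \<cdot>\<^sub>v v)" by simp
    then show "u = v" using \<mu> by (simp add: smult_smult_assoc)
  qed
  moreover have "(\<lambda>v. B *\<^sub>v v) ` mat_kernel (char_matrix (A * B) \<mu>) = mat_kernel (char_matrix (B * A) \<mu>)"
  proof (intro equalityI subsetI)
    fix w assume w: "w \<in> mat_kernel (char_matrix (B * A) \<mu>)"
    let ?v = "inverse \<mu> \<cdot>\<^sub>v (A *\<^sub>v w)"
    have "?v \<in> mat_kernel (char_matrix (A * B) \<mu>)"
      using BA_ker(1)[OF w] mat_kernel_smult[OF cAB] by blast
    moreover have "B *\<^sub>v ?v = w"
      using BA_ker(2,3)[OF w] mult_mat_vec[OF B, of "A *\<^sub>v w" "inverse \<mu>"] A \<mu>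
      by (simp add: smult_smult_assoc)
    ultimately show "w \<in> (\<lambda>v. B *\<^sub>v v) ` mat_kernel (char_matrix (A * B) \<mu>)"
      by (metis image_eqI)
  qed (use AB_ker(1) in auto)
  ultimately have "AB.Ker.dim = BA.Ker.dim" using lm.dim_eq by simp
  then show ?thesis by (simp add: geom_mult_def)
qed

section \<open>Positivity from balanced weights\<close>

text \<open>
The weights make \<open>F\<close> the adjoint of \<open>D\<close> for the inner products weighted by \<open>e\<close> and \<open>d\<close>, so
\<open>D F\<close> is positive semidefinite for the latter: an eigenvector \<open>x\<close> and \<open>y = F x\<close> satisfy
\<open>\<phi> \<langle>x, x\<rangle> = \<langle>D F x, x\<rangle> = \<langle>y, y\<rangle>\<close>.
\<close>

lemma balanced_product_eigenvalue_nonneg: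
  fixes D F :: "complex mat" and d e :: "nat \<Rightarrow> real"
  assumes D: "D \<in> carrier_mat n m" and F: "F \<in> carrier_mat m n"
    and d: "\<And>i. i < n \<Longrightarrow> d i > 0" and e: "\<And>j. j < m \<Longrightarrow> e j > 0"
    and balanced: "\<And>i j. i < n \<Longrightarrow> j < m \<Longrightarrow>
      complex_of_real (d i) * D $$ (i, j) = of_real (e j) * cnj (F $$ (j, i))"
    and ev: "eigenvalue (D * F) \<phi>"
  shows "\<phi> \<in> \<real> \<and> Re \<phi> \<ge> 0"
proof -
  obtain x where x: "x \<in> carrier_vec n" "x \<noteq> 0\<^sub>v n" and "(D * F) *\<^sub>v x = \<phi> \<cdot>\<^sub>v x"
    using ev D F by (auto simp: eigenvalue_def eigenvector_def)
  then have Dy: "D *\<^sub>v (F *\<^sub>v x) = \<phi> \<cdot>\<^sub>v x" using D F by simp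
  define y where "y = F *\<^sub>v x"
  have y: "y $ j = (\<Sum>i<n. F $$ (j, i) * x $ i)" if "j < m" for j
    using that F x by (simp add: y_def scalar_prod_def atLeast0LessThan)
  have Dy: "(\<Sum>j<m. D $$ (i, j) * y $ j) = \<phi> * x $ i" if "i < n" for i
    using that D F x arg_cong[OF Dy, of "\<lambda>v. v $ i"]
    by (simp add: y_def[symmetric] scalar_prod_def atLeast0LessThan) (simp add: y_def)
  define r where "r = (\<Sum>i<n. d i * (cmod (x $ i))\<^sup>2)"
  define s where "s = (\<Sum>j<m. e j * (cmod (y $ j))\<^sup>2)"
  have cmod_sq: "complex_of_real (cmod w) ^ 2 = w * cnj w" for w
    using complex_norm_square[of w] by simp
  have "\<phi> * of_real r = (\<Sum>i<n. of_real (d i) * cnj (x $ i) * (\<phi> * x $ i))"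
    by (simp add: r_def sum_distrib_left cmod_sq algebra_simps)
  also have "\<dots> = (\<Sum>i<n. of_real (d i) * cnj (x $ i) * (\<Sum>j<m. D $$ (i, j) * y $ j))"
    by (simp add: Dy)
  also have "\<dots> = (\<Sum>i<n. \<Sum>j<m. (of_real (d i) * D $$ (i, j)) * cnj (x $ i) * y $ j)"
    by (simp add: sum_distrib_left algebra_simps)
  also have "\<dots> = (\<Sum>i<n. \<Sum>j<m. of_real (e j) * y $ j * (cnj (F $$ (j, i)) * cnj (x $ i)))"
    by (simp add: balanced algebra_simps)
  also have "\<dots> = (\<Sum>j<m. of_real (e j) * y $ j * cnj (y $ j))"
    by (subst sum.swap) (simp add: y sum_distrib_left)
  also have "\<dots> = of_real s"
    by (simp add: s_def cmod_sq algebra_simps)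
  finally have \<phi>: "\<phi> * of_real r = of_real s" .
  obtain i where "i < n" "x $ i \<noteq> 0" using x by (metis eq_vecI carrier_vecD index_zero_vec)
  then have "r > 0"
    unfolding r_def using d by (intro sum_pos2[of _ i]) (auto simp: less_imp_le)
  moreover have "s \<ge> 0"
    unfolding s_def using e by (intro sum_nonneg) (auto simp: less_imp_le)
  moreover have "\<phi> = of_real (s / r)" using \<phi> \<open>r > 0\<close> by (simp add: field_simps)
  ultimately show ?thesis by simp
qed

section \<open>Eigenvalues of the Coxeter transformation\<close>

lemma w1_mat_involution:
  assumes D: "D \<in> carrier_mat n m"
  shows "w1_mat D * w1_mat D = 1\<^sub>m (n + m)"
  using D unfolding w1_mat_def
  by (subst mult_four_block_mat[of _ n n _ m _ m _ _ n _ m])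
    (auto intro!: trans[OF cong_four_block_mat four_block_one_mat])

text \<open>
Since \<open>w\<^sub>1\<close> is an involution, \<open>w\<^sub>1 w\<^sub>2 u = z u\<close> is the same as \<open>w\<^sub>2 u = z w\<^sub>1 u\<close>. Each of
the two factors changes only one block of \<open>u = (x, y)\<close>, so no product of \<open>D\<close> and \<open>F\<close> enters.
The factor \<open>z\<close> is not divided out, so that \<open>z = 0\<close> is covered.
\<close>

lemma coxeter_eigen_equations:
  assumes D: "D \<in> carrier_mat n m" and F: "F \<in> carrier_mat m n"
    and x: "x \<in> carrier_vec n" and y: "y \<in> carrier_vec m"
  shows "coxeter_transformation D F *\<^sub>v (x @\<^sub>v y) = z \<cdot>\<^sub>v (x @\<^sub>v y) \<longleftrightarrow>
    F *\<^sub>v x = (- (1 + z) / 2) \<cdot>\<^sub>v y \<and> (2 * z) \<cdot>\<^sub>v (D *\<^sub>v y) = - (1 + z) \<cdot>\<^sub>v x"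
proof -
  define a where "a = F *\<^sub>v x"
  define b where "b = D *\<^sub>v y"
  have ab: "a \<in> carrier_vec m" "b \<in> carrier_vec n"
    using D F x y by (auto simp: a_def b_def)
  have W1: "w1_mat D \<in> carrier_mat (n + m) (n + m)" and W2: "w2_mat F \<in> carrier_mat (n + m) (n + m)"
    using D F by (auto simp: w1_mat_def w2_mat_def)
  let ?u = "x @\<^sub>v y"
  have u: "?u \<in> carrier_vec (n + m)" using x y by simp
  have w1w1: "w1_mat D *\<^sub>v (w1_mat D *\<^sub>v v) = v" if "v \<in> carrier_vec (n + m)" for v
    using that W1 by (simp flip: assoc_mult_mat_vec add: w1_mat_involution[OF D])
  have C: "coxeter_transformation D F *\<^sub>v ?u = w1_mat D *\<^sub>v (w2_mat F *\<^sub>v ?u)"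
    unfolding coxeter_transformation_def using W1 W2 u by simp
  have zu: "w1_mat D *\<^sub>v (z \<cdot>\<^sub>v (w1_mat D *\<^sub>v ?u)) = z \<cdot>\<^sub>v ?u"
    using mult_mat_vec[OF W1, of "w1_mat D *\<^sub>v ?u" z] W1 u w1w1[OF u] by auto
  have "coxeter_transformation D F *\<^sub>v ?u = z \<cdot>\<^sub>v ?u \<longleftrightarrow> w2_mat F *\<^sub>v ?u = z \<cdot>\<^sub>v (w1_mat D *\<^sub>v ?u)"
  proof
    assume "coxeter_transformation D F *\<^sub>v ?u = z \<cdot>\<^sub>v ?u"
    then have "w1_mat D *\<^sub>v (w1_mat D *\<^sub>v (w2_mat F *\<^sub>v ?u)) = z \<cdot>\<^sub>v (w1_mat D *\<^sub>v ?u)"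
      using mult_mat_vec[OF W1 u] by (simp add: C)
    then show "w2_mat F *\<^sub>v ?u = z \<cdot>\<^sub>v (w1_mat D *\<^sub>v ?u)" using W2 u w1w1 by simp
  qed (simp add: C zu)
  also have "w2_mat F *\<^sub>v ?u = x @\<^sub>v (- (2 \<cdot>\<^sub>v a) - y)"
  proof -
    have "x + 0\<^sub>m n m *\<^sub>v y = x" "- (2 \<cdot>\<^sub>m F) *\<^sub>v x + - 1\<^sub>m m *\<^sub>v y = - (2 \<cdot>\<^sub>v a) - y"
      using F x y by (auto simp: a_def)
    then show ?thesis
      unfolding w2_mat_def using F x y
      by (subst four_block_mat_mult_vec[of _ n n _ m _ m]) auto
  qed
  also have "w1_mat D *\<^sub>v ?u = (- x - 2 \<cdot>\<^sub>v b) @\<^sub>v y"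
  proof -
    have "- 1\<^sub>m n *\<^sub>v x + - (2 \<cdot>\<^sub>m D) *\<^sub>v y = - x - 2 \<cdot>\<^sub>v b" "0\<^sub>m m n *\<^sub>v x + y = y"
      using D x y by (auto simp: b_def)
    then show ?thesis
      unfolding w1_mat_def using D x y
      by (subst four_block_mat_mult_vec[of _ n n _ m _ m]) auto
  qed
  also have "x @\<^sub>v (- (2 \<cdot>\<^sub>v a) - y) = z \<cdot>\<^sub>v ((- x - 2 \<cdot>\<^sub>v b) @\<^sub>v y) \<longleftrightarrow>
      x = z \<cdot>\<^sub>v (- x - 2 \<cdot>\<^sub>v b) \<and> - (2 \<cdot>\<^sub>v a) - y = z \<cdot>\<^sub>v y"
  proof -
    have "z \<cdot>\<^sub>v ((- x - 2 \<cdot>\<^sub>v b) @\<^sub>v y) = (z \<cdot>\<^sub>v (- x - 2 \<cdot>\<^sub>v b)) @\<^sub>v (z \<cdot>\<^sub>v y)"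
      using x y ab by (intro eq_vecI) auto
    then show ?thesis using x ab append_vec_eq[of x n "z \<cdot>\<^sub>v (- x - 2 \<cdot>\<^sub>v b)"] by auto
  qed
  also have "x = z \<cdot>\<^sub>v (- x - 2 \<cdot>\<^sub>v b) \<longleftrightarrow> (2 * z) \<cdot>\<^sub>v b = - (1 + z) \<cdot>\<^sub>v x"
  proof -
    have "X = z * (- X - 2 * B) \<longleftrightarrow> 2 * z * B = - (1 + z) * X" for X B
    proof -
      have "X - z * (- X - 2 * B) = 2 * z * B - - (1 + z) * X" by (simp add: algebra_simps)
      then show ?thesis by (metis eq_iff_diff_eq_0)
    qed
    then show ?thesis using x ab by (auto simp: vec_eq_iff)
  qed
  also have "- (2 \<cdot>\<^sub>v a) - y = z \<cdot>\<^sub>v y \<longleftrightarrow> a = (- (1 + z) / 2) \<cdot>\<^sub>v y"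
  proof -
    have "- (2 * A) - Y = z * Y \<longleftrightarrow> A = - (1 + z) / 2 * Y" for A Y :: complex
    proof -
      have "- (2 * A) - Y - z * Y = - 2 * (A - - (1 + z) / 2 * Y)" by (simp add: field_simps)
      then show ?thesis by (metis eq_iff_diff_eq_0 mult_eq_0_iff neg_equal_0_iff_equal zero_neq_numeral)
    qed
    then show ?thesis using y ab by (auto simp: vec_eq_iff)
  qed
  finally show ?thesis by (auto simp: a_def b_def)
qed

text \<open>
Composing \<open>Q x = \<alpha> y\<close> with \<open>P y = \<beta> x\<close> gives \<open>P Q x = \<alpha> \<beta> x\<close> and \<open>Q P y = \<alpha> \<beta> y\<close>, and
at least one of \<open>x\<close>, \<open>y\<close> is nonzero. Conversely an eigenvector \<open>x\<close> of \<open>P Q\<close> is completed by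
\<open>y = Q x / \<alpha>\<close> when \<open>\<alpha> \<noteq> 0\<close>. For \<open>\<alpha> = 0 \<noteq> \<beta>\<close> the equivalence would fail, as for a column
\<open>P\<close> and a row \<open>Q\<close> with entries 1 and 0: then \<open>P Q\<close> is singular, but the coupled equations have
only the zero solution. When both vanish, \<open>x\<close> and \<open>y\<close> decouple into kernel vectors
of \<open>Q\<close> and \<open>P\<close>, and either \<open>x\<close> or \<open>Q x\<close> provides one.
\<close>

lemma coupled_eigenvectors_iff:
  fixes P Q :: "'a :: field mat"
  assumes P: "P \<in> carrier_mat n m" and Q: "Q \<in> carrier_mat m n" and zero: "\<alpha> = 0 \<longleftrightarrow> \<beta> = 0"
  shows "(\<exists>x\<in>carrier_vec n. \<exists>y\<in>carrier_vec m. (x \<noteq> 0\<^sub>v n \<or> y \<noteq> 0\<^sub>v m) \<and>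
           Q *\<^sub>v x = \<alpha> \<cdot>\<^sub>v y \<and> P *\<^sub>v y = \<beta> \<cdot>\<^sub>v x)
    \<longleftrightarrow> eigenvalue (P * Q) (\<alpha> * \<beta>) \<or> eigenvalue (Q * P) (\<alpha> * \<beta>)" (is "?L \<longleftrightarrow> ?R")
proof
  have compose: "eigenvalue (A * B) (a * b)"
    if "A \<in> carrier_mat i j" "B \<in> carrier_mat j i" "x \<in> carrier_vec i" "y \<in> carrier_vec j"
      "x \<noteq> 0\<^sub>v i" "B *\<^sub>v x = a \<cdot>\<^sub>v y" "A *\<^sub>v y = b \<cdot>\<^sub>v x"
    for A B :: "'a mat" and i j x y a b
    using that mult_mat_vec[of A i j y a]
    by (auto simp: eigenvalue_def eigenvector_def smult_smult_assoc intro!: exI[of _ x])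
  assume ?L
  then show ?R using compose[OF P Q] compose[OF Q P] by (metis mult.commute)
next
  have split: "\<exists>x\<in>carrier_vec i. \<exists>y\<in>carrier_vec j. (x \<noteq> 0\<^sub>v i \<or> y \<noteq> 0\<^sub>v j) \<and>
      B *\<^sub>v x = a \<cdot>\<^sub>v y \<and> A *\<^sub>v y = b \<cdot>\<^sub>v x"
    if A: "A \<in> carrier_mat i j" and B: "B \<in> carrier_mat j i" and ab: "a = 0 \<longleftrightarrow> b = 0"
      and ev: "eigenvalue (A * B) (a * b)"
    for A B :: "'a mat" and i j a b
  proof -
    obtain x where x: "x \<in> carrier_vec i" "x \<noteq> 0\<^sub>v i" and "(A * B) *\<^sub>v x = (a * b) \<cdot>\<^sub>v x"
      using ev A B by (auto simp: eigenvalue_def eigenvector_def)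
    then have ABx: "A *\<^sub>v (B *\<^sub>v x) = (a * b) \<cdot>\<^sub>v x" using A B by simp
    show ?thesis
    proof (cases "a = 0")
      case False
      let ?y = "inverse a \<cdot>\<^sub>v (B *\<^sub>v x)"
      have "B *\<^sub>v x = a \<cdot>\<^sub>v ?y" using False B by (simp add: smult_smult_assoc)
      moreover have "A *\<^sub>v ?y = b \<cdot>\<^sub>v x"
        using mult_mat_vec[OF A mult_mat_vec_carrier[OF B x(1)], of "inverse a"] False
        by (simp add: ABx smult_smult_assoc mult.assoc[symmetric])
      moreover have "?y \<in> carrier_vec j" using mult_mat_vec_carrier[OF B x(1)] by simp
      ultimately show ?thesis using x by blast
    next
      case True
      have zeros: "B *\<^sub>v 0\<^sub>v i = 0\<^sub>v j" "A *\<^sub>v 0\<^sub>v j = 0\<^sub>v i" "0 \<cdot>\<^sub>v 0\<^sub>v j = (0\<^sub>v j :: 'a vec)" "0 \<cdot>\<^sub>v 0\<^sub>v i = (0\<^sub>v i :: 'a vec)"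
        "0 \<cdot>\<^sub>v x = 0\<^sub>v i" "0 \<cdot>\<^sub>v (B *\<^sub>v x) = 0\<^sub>v j"
        using A B x by auto
      show ?thesis
      proof (cases "B *\<^sub>v x = 0\<^sub>v j")
        case Bx: True
        show ?thesis
          using True ab x Bx zeros by (intro bexI[of _ x] bexI[of _ "0\<^sub>v j"]) simp_all
      next
        case False
        then show ?thesis
          using True ab x ABx zeros B by (intro bexI[of _ "0\<^sub>v i"] bexI[of _ "B *\<^sub>v x"]) simp_all
      qed
    qed
  qed
  assume ?R
  then show ?L using split[OF P Q zero] split[OF Q P] zero by (metis mult.commute)
qed

text \<open>
For \<open>z \<noteq> 0\<close> the eigenvector equations of the Coxeter transformation couple \<open>x\<close> and \<open>y\<close> with
\<open>\<alpha> = - (1 + z) / 2\<close> and \<open>\<beta> = - (1 + z) / (2 z)\<close>, and \<open>\<alpha> \<beta> = (z + 1)\<^sup>2 / (4 z)\<close> is the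
number that \<open>D F\<close> or \<open>F D\<close> must have as an eigenvalue. Both coefficients
vanish exactly at \<open>z = - 1\<close>, which corresponds to the kernels of \<open>D\<close> and \<open>F\<close>.
\<close>

lemma coxeter_eigenvalue_iff:
  assumes D: "D \<in> carrier_mat n m" and F: "F \<in> carrier_mat m n"
  shows "eigenvalue (coxeter_transformation D F) z \<longleftrightarrow> z \<noteq> 0 \<and>
    (eigenvalue (D * F) ((z + 1)\<^sup>2 / (4 * z)) \<or> eigenvalue (F * D) ((z + 1)\<^sup>2 / (4 * z)))"
proof -
  let ?C = "coxeter_transformation D F"
  have C: "?C \<in> carrier_mat (n + m) (n + m)"
    using D F by (auto simp: coxeter_transformation_def w1_mat_def w2_mat_def)
  have "eigenvalue ?C z \<longleftrightarrow> (\<exists>u\<in>carrier_vec (n + m). u \<noteq> 0\<^sub>v (n + m) \<and> ?C *\<^sub>v u = z \<cdot>\<^sub>v u)"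
    using C by (auto simp: eigenvalue_def eigenvector_def)
  also have "\<dots> \<longleftrightarrow> (\<exists>x\<in>carrier_vec n. \<exists>y\<in>carrier_vec m. x @\<^sub>v y \<noteq> 0\<^sub>v (n + m) \<and>
      ?C *\<^sub>v (x @\<^sub>v y) = z \<cdot>\<^sub>v (x @\<^sub>v y))"
    (is "(\<exists>u\<in>_. ?E u) \<longleftrightarrow> _")
  proof
    assume "\<exists>u\<in>carrier_vec (n + m). ?E u"
    then obtain u where u: "u \<in> carrier_vec (n + m)" "?E u" by blast
    then have "?E (vec_first u n @\<^sub>v vec_last u m)" by simp
    then show "\<exists>x\<in>carrier_vec n. \<exists>y\<in>carrier_vec m. ?E (x @\<^sub>v y)" by fastforce
  next
    assume "\<exists>x\<in>carrier_vec n. \<exists>y\<in>carrier_vec m. ?E (x @\<^sub>v y)"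
    then show "\<exists>u\<in>carrier_vec (n + m). ?E u" by (meson append_carrier_vec)
  qed
  also have "\<dots> \<longleftrightarrow> (\<exists>x\<in>carrier_vec n. \<exists>y\<in>carrier_vec m. (x \<noteq> 0\<^sub>v n \<or> y \<noteq> 0\<^sub>v m) \<and>
      F *\<^sub>v x = (- (1 + z) / 2) \<cdot>\<^sub>v y \<and> (2 * z) \<cdot>\<^sub>v (D *\<^sub>v y) = - (1 + z) \<cdot>\<^sub>v x)"
  proof (intro bex_cong refl)
    fix x y :: "complex vec" assume xy: "x \<in> carrier_vec n" "y \<in> carrier_vec m"
    have "0\<^sub>v (n + m) = 0\<^sub>v n @\<^sub>v (0\<^sub>v m :: complex vec)" by (intro eq_vecI) auto
    then show "(x @\<^sub>v y \<noteq> 0\<^sub>v (n + m) \<and> ?C *\<^sub>v (x @\<^sub>v y) = z \<cdot>\<^sub>v (x @\<^sub>v y)) \<longleftrightarrow>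
      ((x \<noteq> 0\<^sub>v n \<or> y \<noteq> 0\<^sub>v m) \<and>
      F *\<^sub>v x = (- (1 + z) / 2) \<cdot>\<^sub>v y \<and> (2 * z) \<cdot>\<^sub>v (D *\<^sub>v y) = - (1 + z) \<cdot>\<^sub>v x)"
      using coxeter_eigen_equations[OF D F xy] append_vec_eq[OF xy(1) zero_carrier_vec] by auto
  qed
  also have "\<dots> \<longleftrightarrow> z \<noteq> 0 \<and>
    (eigenvalue (D * F) ((z + 1)\<^sup>2 / (4 * z)) \<or> eigenvalue (F * D) ((z + 1)\<^sup>2 / (4 * z)))"
  proof (cases "z = 0")
    case True
    have "x = 0\<^sub>v n \<and> y = 0\<^sub>v m" if "x \<in> carrier_vec n" "y \<in> carrier_vec m"
      "F *\<^sub>v x = (- 1 / 2) \<cdot>\<^sub>v y" "0 \<cdot>\<^sub>v (D *\<^sub>v y) = - 1 \<cdot>\<^sub>v x" for x y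
    proof -
      have "x = 0\<^sub>v n" using that D by (auto simp: vec_eq_iff)
      moreover from this have "F *\<^sub>v x = 0\<^sub>v m" using F by auto
      then have "y = 0\<^sub>v m" using that by (auto simp: vec_eq_iff)
      ultimately show ?thesis by blast
    qed
    then show ?thesis using True by auto
  next
    case False
    define \<alpha> where "\<alpha> = - (1 + z) / 2"
    define \<beta> where "\<beta> = - (1 + z) / (2 * z)"
    have "(2 * z) \<cdot>\<^sub>v (D *\<^sub>v y) = - (1 + z) \<cdot>\<^sub>v x \<longleftrightarrow> D *\<^sub>v y = \<beta> \<cdot>\<^sub>v x"
      if "x \<in> carrier_vec n" for x y
    proof -
      have "2 * z * B = - (1 + z) * X \<longleftrightarrow> B = \<beta> * X" for B X
        using False unfolding \<beta>_def by (simp add: field_simps)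
      then show ?thesis using that D by (auto simp: vec_eq_iff)
    qed
    moreover have "\<alpha> = 0 \<longleftrightarrow> \<beta> = 0" using False by (simp add: \<alpha>_def \<beta>_def)
    moreover have "\<alpha> * \<beta> = (z + 1)\<^sup>2 / (4 * z)"
      using False by (simp add: \<alpha>_def \<beta>_def power2_eq_square field_simps)
    ultimately show ?thesis
      unfolding \<alpha>_def[symmetric] using False coupled_eigenvectors_iff[OF D F, of \<alpha> \<beta>] by simp
  qed
  finally show ?thesis .
qed

section \<open>The quadratic equation for the eigenvalues\<close>

lemma lambda_sum_prod: "lambda1 \<phi> + lambda2 \<phi> = 4 * \<phi> - 2" "lambda1 \<phi> * lambda2 \<phi> = 1"
proof -
  have "lambda1 \<phi> * lambda2 \<phi> = (2 * \<phi> - 1)\<^sup>2 - 4 * (csqrt (\<phi> * (\<phi> - 1)))\<^sup>2"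
    by (simp add: lambda1_def lambda2_def power2_eq_square algebra_simps)
  also have "\<dots> = 1" unfolding power2_csqrt by (simp add: power2_eq_square algebra_simps)
  finally show "lambda1 \<phi> * lambda2 \<phi> = 1" .
qed (simp add: lambda1_def lambda2_def)

text \<open>
With denominators cleared the equation is \<open>z\<^sup>2 - (4 \<phi> - 2) z + 1 = 0\<close>; its roots have the sum and
the product computed above, and product 1 excludes the root 0.
\<close>

lemma lambda_solutions:
  "z \<noteq> 0 \<and> \<phi> = (z + 1)\<^sup>2 / (4 * z) \<longleftrightarrow> z = lambda1 \<phi> \<or> z = lambda2 \<phi>"
proof -
  have "(z - lambda1 \<phi>) * (z - lambda2 \<phi>)
      = z\<^sup>2 - (lambda1 \<phi> + lambda2 \<phi>) * z + lambda1 \<phi> * lambda2 \<phi>"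
    by (simp add: power2_eq_square algebra_simps)
  also have "\<dots> = (z + 1)\<^sup>2 - 4 * z * \<phi>"
    unfolding lambda_sum_prod by (simp add: power2_eq_square algebra_simps)
  finally have "(z - lambda1 \<phi>) * (z - lambda2 \<phi>) = (z + 1)\<^sup>2 - 4 * z * \<phi>" .
  moreover have "lambda1 \<phi> \<noteq> 0" "lambda2 \<phi> \<noteq> 0" using lambda_sum_prod(2)[of \<phi>] by auto
  moreover have "z \<noteq> 0 \<Longrightarrow> \<phi> = (z + 1)\<^sup>2 / (4 * z) \<longleftrightarrow> (z + 1)\<^sup>2 - 4 * z * \<phi> = 0"
    by (auto simp: field_simps)
  ultimately show ?thesis by (metis eq_iff_diff_eq_0 mult_eq_0_iff)
qed

text \<open>
For \<open>0 \<le> \<phi> \<le> 1\<close> the radicand is nonpositive, the two values are complex conjugates, and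
\<open>(2 \<phi> - 1)\<^sup>2 + 4 \<phi> (1 - \<phi>) = 1\<close>. For \<open>\<phi> > 1\<close> the first value is visibly positive and the
second is its inverse.
\<close>

lemma lambda_unit_circle_or_positive:
  assumes "\<phi> \<in> \<real>" and "Re \<phi> \<ge> 0"
  shows "(cmod (lambda1 \<phi>) = 1 \<and> cmod (lambda2 \<phi>) = 1) \<or> (pos_real (lambda1 \<phi>) \<and> pos_real (lambda2 \<phi>))"
proof -
  obtain t where t: "\<phi> = of_real t" "t \<ge> 0" using assms by (auto elim: Reals_cases)
  have sq: "\<phi> * (\<phi> - 1) = of_real (t * (t - 1))" by (simp add: t)
  show ?thesis
  proof (cases "t \<le> 1")
    case True
    then have nonpos: "t * (t - 1) \<le> 0" using t by (simp add: mult_nonneg_nonpos)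
    then have root: "csqrt (\<phi> * (\<phi> - 1)) = \<i> * of_real (sqrt (t * (1 - t)))"
      unfolding sq by (subst csqrt_of_real_nonpos) (auto simp: algebra_simps)
    have "(2 * t - 1)\<^sup>2 + (2 * sqrt (t * (1 - t)))\<^sup>2 = 1"
      using nonpos by (simp add: power_mult_distrib algebra_simps power2_eq_square)
    then show ?thesis
      unfolding lambda1_def lambda2_def root by (simp add: cmod_def t)
  next
    case False
    then have root: "csqrt (\<phi> * (\<phi> - 1)) = of_real (sqrt (t * (t - 1)))"
      unfolding sq by (subst csqrt_of_real_nonneg) auto
    define s where "s = 2 * t - 1 + 2 * sqrt (t * (t - 1))"
    have "s > 0" unfolding s_def using False by (intro add_pos_nonneg) auto
    moreover have l1: "lambda1 \<phi> = of_real s"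
      unfolding lambda1_def root s_def by (simp add: t)
    moreover have "lambda2 \<phi> = of_real (1 / s)"
      using lambda_sum_prod(2)[of \<phi>] \<open>s > 0\<close> unfolding l1 by (simp add: field_simps)
    ultimately show ?thesis by (simp add: pos_real_def del: of_real_divide)
  qed
qed

section \<open>Eigenvalues attached to a valued tree\<close>

theorem proposition3p3:
  fixes V :: "'v set" and k :: "'v \<Rightarrow> 'v \<Rightarrow> int" and xs ys :: "'v list"
    and D F C :: "complex mat"
  assumes tree: "valued_tree V k"
    and classes: "bipartite_enumeration V k xs ys"
    and D: "D = D_mat k xs ys"
    and F: "F = F_mat k xs ys"
    and C: "C = coxeter_transformation D F"
  shows
    "(\<forall>\<mu>. \<mu> \<noteq> 0 \<longrightarrow>
        (eigenvalue (D * F) \<mu> \<longleftrightarrow> eigenvalue (F * D) \<mu>) \<and>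
        alg_mult (D * F) \<mu> = alg_mult (F * D) \<mu> \<and>
        geom_mult (D * F) \<mu> = geom_mult (F * D) \<mu>)
     \<and>
     (\<forall>\<phi>. eigenvalue (D * F) \<phi> \<or> eigenvalue (F * D) \<phi> \<longrightarrow> \<phi> \<in> \<real> \<and> Re \<phi> \<ge> 0)
     \<and>
     (\<forall>z. eigenvalue C z \<longrightarrow> z \<noteq> 0 \<and>
        (\<exists>\<phi>. (eigenvalue (D * F) \<phi> \<or> eigenvalue (F * D) \<phi>) \<and> \<phi> = (z + 1)\<^sup>2 / (4 * z)))
     \<and>
     (\<forall>\<phi>. eigenvalue (D * F) \<phi> \<or> eigenvalue (F * D) \<phi> \<longrightarrow>
        {z. eigenvalue C z \<and> z \<noteq> 0 \<and> \<phi> = (z + 1)\<^sup>2 / (4 * z)} = {lambda1 \<phi>, lambda2 \<phi>} \<and>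
        ((cmod (lambda1 \<phi>) = 1 \<and> cmod (lambda2 \<phi>) = 1) \<or>
         (pos_real (lambda1 \<phi>) \<and> pos_real (lambda2 \<phi>))) \<and>
        (pos_real (lambda1 \<phi>) \<and> pos_real (lambda2 \<phi>) \<longrightarrow> lambda1 \<phi> * lambda2 \<phi> = 1))"
proof -
  define n where "n = length xs"
  define m where "m = length ys"
  have Dc: "D \<in> carrier_mat n m" and Fc: "F \<in> carrier_mat m n"
    by (simp_all add: D F D_mat_def F_mat_def cartan_block_def n_def m_def)
  have commute: "eigenvalue (D * F) \<mu> \<longleftrightarrow> eigenvalue (F * D) \<mu>"
    "alg_mult (D * F) \<mu> = alg_mult (F * D) \<mu>" "geom_mult (D * F) \<mu> = geom_mult (F * D) \<mu>"
    if "\<mu> \<noteq> 0" for \<mu>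
    using that eigenvalue_mult_commute[OF Dc Fc] alg_mult_mult_commute[OF Dc Fc]
      geom_mult_mult_commute[OF Dc Fc] by blast+
  have V: "\<And>i. i < n \<Longrightarrow> xs ! i \<in> V" "\<And>j. j < m \<Longrightarrow> ys ! j \<in> V"
    using classes by (auto simp: bipartite_enumeration_def n_def m_def)
  obtain d :: "'v \<Rightarrow> real" where pos: "\<And>v. v \<in> V \<Longrightarrow> d v > 0"
    and bal: "\<And>u v. u \<in> V \<Longrightarrow> v \<in> V \<Longrightarrow> d u * of_int (k u v) = d v * of_int (k v u)"
    using forest_symmetrizable[of V k] tree unfolding valued_tree_def by blast
  have nonneg_DF: "\<phi> \<in> \<real> \<and> Re \<phi> \<ge> 0" if "eigenvalue (D * F) \<phi>" for \<phi>
  proof (rule balanced_product_eigenvalue_nonneg[OF Dc Fc _ _ _ that])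
    fix i j assume ij: "i < n" "j < m"
    have "complex_of_real (d (xs ! i) * of_int (k (xs ! i) (ys ! j)))
        = complex_of_real (d (ys ! j) * of_int (k (ys ! j) (xs ! i)))"
      by (simp only: bal[OF V(1)[OF ij(1)] V(2)[OF ij(2)]])
    then show "complex_of_real (d (xs ! i)) * D $$ (i, j) = of_real (d (ys ! j)) * cnj (F $$ (j, i))"
      using ij by (simp add: D F D_mat_def F_mat_def cartan_block_def n_def m_def)
  qed (simp_all add: pos V)
  \<comment> \<open>For \<open>F D\<close> only nonzero eigenvalues need an argument, and these are shared with \<open>D F\<close>.\<close>
  have nonneg: "\<phi> \<in> \<real> \<and> Re \<phi> \<ge> 0"
    if "eigenvalue (D * F) \<phi> \<or> eigenvalue (F * D) \<phi>" for \<phi>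
    using that nonneg_DF commute(1) by (cases "\<phi> = 0") auto
  note C_iff = coxeter_eigenvalue_iff[OF Dc Fc, folded C]
  have solutions: "{z. eigenvalue C z \<and> z \<noteq> 0 \<and> \<phi> = (z + 1)\<^sup>2 / (4 * z)} = {lambda1 \<phi>, lambda2 \<phi>}"
    if "eigenvalue (D * F) \<phi> \<or> eigenvalue (F * D) \<phi>" for \<phi>
  proof (rule Set.set_eqI)
    fix z
    have "eigenvalue C z \<and> z \<noteq> 0 \<and> \<phi> = (z + 1)\<^sup>2 / (4 * z) \<longleftrightarrow>
        z \<noteq> 0 \<and> \<phi> = (z + 1)\<^sup>2 / (4 * z)"
      using that C_iff[of z] by auto
    then show "z \<in> {z. eigenvalue C z \<and> z \<noteq> 0 \<and> \<phi> = (z + 1)\<^sup>2 / (4 * z)} \<longleftrightarrow>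
        z \<in> {lambda1 \<phi>, lambda2 \<phi>}"
      using lambda_solutions[of z \<phi>] by simp
  qed
  show ?thesis
  proof (intro conjI[OF _ conjI[OF _ conjI]] allI impI)
    fix \<mu> :: complex assume "\<mu> \<noteq> 0"
    then show "(eigenvalue (D * F) \<mu> \<longleftrightarrow> eigenvalue (F * D) \<mu>) \<and>
        alg_mult (D * F) \<mu> = alg_mult (F * D) \<mu> \<and> geom_mult (D * F) \<mu> = geom_mult (F * D) \<mu>"
      using commute by simp
  next
    fix \<phi> assume "eigenvalue (D * F) \<phi> \<or> eigenvalue (F * D) \<phi>"
    then show "\<phi> \<in> \<real> \<and> Re \<phi> \<ge> 0" by (rule nonneg)
  next
    fix z assume "eigenvalue C z"
    then show "z \<noteq> 0 \<and>
        (\<exists>\<phi>. (eigenvalue (D * F) \<phi> \<or> eigenvalue (F * D) \<phi>) \<and> \<phi> = (z + 1)\<^sup>2 / (4 * z))"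
      unfolding C_iff by blast
  next
    fix \<phi> assume ev: "eigenvalue (D * F) \<phi> \<or> eigenvalue (F * D) \<phi>"
    then have "(cmod (lambda1 \<phi>) = 1 \<and> cmod (lambda2 \<phi>) = 1) \<or>
        (pos_real (lambda1 \<phi>) \<and> pos_real (lambda2 \<phi>))"
      using nonneg lambda_unit_circle_or_positive by blast
    then show "{z. eigenvalue C z \<and> z \<noteq> 0 \<and> \<phi> = (z + 1)\<^sup>2 / (4 * z)} = {lambda1 \<phi>, lambda2 \<phi>} \<and>
        ((cmod (lambda1 \<phi>) = 1 \<and> cmod (lambda2 \<phi>) = 1) \<or>
         (pos_real (lambda1 \<phi>) \<and> pos_real (lambda2 \<phi>))) \<and>
        (pos_real (lambda1 \<phi>) \<and> pos_real (lambda2 \<phi>) \<longrightarrow> lambda1 \<phi> * lambda2 \<phi> = 1)"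
      by (simp only: solutions[OF ev] lambda_sum_prod(2) simp_thms)
  qed
qed

end
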